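(* Let $E$ be an ellipse in the Euclidean plane $\mathbb{R}^2$ with semi-major axis $a$ and semi-minor axis $b$. Let $v_1,v_2$ be linearly independent unit vectors, each of which is perpendicular to one of the diagonal lines of the rectangle circumscribed about $E$ whose sides are parallel to the axes of $E$. Then, for $\lambda_1=\lambda_2=1$, $E$ is a $(v_1,v_2)$-Euclidean circle with the same center and with radius $\dfrac{\sqrt{2}\,ab}{\sqrt{a^2+b^2}}$.
   Context: Write $v_i=(v_{i1},v_{i2})$. For $\lambda_1=\lambda_2=1$ the $(v_1,v_2)$-Euclidean distance between $P_1=(x_1,y_1)$ and $P_2=(x_2,y_2)$ is $$d_{E(v_1,v_2)}(P_1,P_2)=\left[(v_{11}(x_1-x_2)+v_{12}(y_1-y_2))^2+(v_{21}(x_1-x_2)+v_{22}(y_1-y_2))^2\right]^{1/2},$$ and the $(v_1,v_2)$-Euclidean circle with center $C$ and radius $r>0$ is the set $\{P\in\mathbb{R}^2: d_{E(v_1,v_2)}(C,P)=r\}$. Ellipses include Euclidean circles ($a=b$), for which any two perpendicular lines through the center may be taken as axes. The center of an ellipse is its center of symmetry. The circumscribed rectangle has its four sides tangent to $E$ (side lengths $2a$ and $2b$). *)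

theory Defs
  imports "HOL-Analysis.Analysis"
begin

text \<open>Lines are affine hulls of two distinct points.  \<open>A\<close> is the line carrying the major axis,
  \<open>B\<close> the line carrying the minor axis; when \<open>a = b\<close> any two perpendicular lines through the
  centre qualify.\<close>

definition ellipse_with_axes ::
    "(real^2) set \<Rightarrow> (real^2) set \<Rightarrow> (real^2) set \<Rightarrow> real \<Rightarrow> real \<Rightarrow> bool" where
  "ellipse_with_axes E A B a b \<longleftrightarrow>
     0 < b \<and> b \<le> a \<and>
     (\<exists>c u w. norm u = 1 \<and> norm w = 1 \<and> orthogonal u w \<and>
        A = affine hull {c, c + u} \<and> B = affine hull {c, c + w} \<and>
        E = {P. ((P - c) \<bullet> u)\<^sup>2 / a\<^sup>2 + ((P - c) \<bullet> w)\<^sup>2 / b\<^sup>2 = 1})"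

definition center_of_symmetry :: "(real^2) set \<Rightarrow> real^2 \<Rightarrow> bool" where
  "center_of_symmetry S c \<longleftrightarrow> (\<lambda>P. 2 *\<^sub>R c - P) ` S = S"

text \<open>The line \<open>L\<close> is tangent to the curve \<open>S\<close> at \<open>T\<close> if it is spanned by the nonzero velocity
  of a path that stays in \<open>S\<close> and passes through \<open>T\<close>.\<close>

definition tangent_line_at :: "(real^2) set \<Rightarrow> real^2 \<Rightarrow> (real^2) set \<Rightarrow> bool" where
  "tangent_line_at S T L \<longleftrightarrow>
     (\<exists>(\<gamma> :: real \<Rightarrow> real^2) d. (\<forall>t. \<gamma> t \<in> S) \<and> \<gamma> 0 = T \<and>
        (\<gamma> has_vector_derivative d) (at 0) \<and> d \<noteq> 0 \<and> L = affine hull {T, T + d})"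

definition side_tangent :: "(real^2) set \<Rightarrow> real^2 \<Rightarrow> real^2 \<Rightarrow> bool" where
  "side_tangent S p q \<longleftrightarrow> (\<exists>T \<in> closed_segment p q. tangent_line_at S T (affine hull {p, q}))"

text \<open>Vertices are listed in cyclic order, so the diagonals are \<open>pr\<close> and \<open>qs\<close>.\<close>

definition rectangle :: "real^2 \<Rightarrow> real^2 \<Rightarrow> real^2 \<Rightarrow> real^2 \<Rightarrow> bool" where
  "rectangle p q r s \<longleftrightarrow>
     p \<noteq> q \<and> p \<noteq> s \<and> r - q = s - p \<and> orthogonal (q - p) (s - p)"

definition circumscribed_rectangle ::
    "(real^2) set \<Rightarrow> (real^2) set \<Rightarrow> (real^2) set \<Rightarrow> real^2 \<Rightarrow> real^2 \<Rightarrow> real^2 \<Rightarrow> real^2 \<Rightarrow> bool" where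
  "circumscribed_rectangle E A B p q r s \<longleftrightarrow>
     rectangle p q r s \<and>
     (\<forall>(x, y) \<in> {(p, q), (q, r), (r, s), (s, p)}.
        side_tangent E x y \<and>
        (affine_parallel (affine hull {x, y}) A \<or> affine_parallel (affine hull {x, y}) B))"

definition perpendicular_to_line :: "real^2 \<Rightarrow> (real^2) set \<Rightarrow> bool" where
  "perpendicular_to_line v L \<longleftrightarrow> (\<forall>P\<in>L. \<forall>Q\<in>L. orthogonal v (P - Q))"

text \<open>The \<open>(v\<^sub>1, v\<^sub>2)\<close>-Euclidean distance for \<open>\<lambda>\<^sub>1 = \<lambda>\<^sub>2 = 1\<close>.\<close>

definition dist_E :: "real^2 \<Rightarrow> real^2 \<Rightarrow> real^2 \<Rightarrow> real^2 \<Rightarrow> real" where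
  "dist_E v1 v2 P1 P2 =
     sqrt ((v1$1 * (P1$1 - P2$1) + v1$2 * (P1$2 - P2$2))\<^sup>2 +
           (v2$1 * (P1$1 - P2$1) + v2$2 * (P1$2 - P2$2))\<^sup>2)"

definition is_circle_E :: "real^2 \<Rightarrow> real^2 \<Rightarrow> (real^2) set \<Rightarrow> real^2 \<Rightarrow> real \<Rightarrow> bool" where
  "is_circle_E v1 v2 S C r \<longleftrightarrow> r > 0 \<and> S = {P. dist_E v1 v2 C P = r}"

end

theory Submission
  imports Defs
begin

text \<open>In coordinates along the axes of \<open>E\<close>, a tangent parallel to one axis touches \<open>E\<close> at an
  end point of the other, so the vertices of the rectangle are \<open>(\<plusminus>a, \<plusminus>b)\<close>.  A unit
  vector \<open>(\<alpha>, \<beta>)\<close> perpendicular to a diagonal thus satisfies \<open>\<alpha>\<^sup>2 = b\<^sup>2 / (a\<^sup>2 + b\<^sup>2)\<close> and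
  \<open>\<beta>\<^sup>2 = a\<^sup>2 / (a\<^sup>2 + b\<^sup>2)\<close>, and by independence \<open>v\<^sub>1\<close> and \<open>v\<^sub>2\<close> have products \<open>\<alpha> \<beta>\<close> of opposite
  sign.  The mixed terms therefore cancel in
  \<open>(\<alpha>\<^sub>1 x + \<beta>\<^sub>1 y)\<^sup>2 + (\<alpha>\<^sub>2 x + \<beta>\<^sub>2 y)\<^sup>2 = 2 (b\<^sup>2 x\<^sup>2 + a\<^sup>2 y\<^sup>2) / (a\<^sup>2 + b\<^sup>2)\<close>.\<close>

lemma inner_real2: "(x::real^2) \<bullet> y = x$1 * y$1 + x$2 * y$2"
  by (simp add: inner_vec_def sum_2)

lemma inner_orthonormal_real2:
  fixes u w x y :: "real^2"
  assumes "norm u = 1" "norm w = 1" "orthogonal u w"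
  shows "x \<bullet> y = (x \<bullet> u) * (y \<bullet> u) + (x \<bullet> w) * (y \<bullet> w)"
proof -
  have u: "u$1 * u$1 + u$2 * u$2 = 1" and w: "w$1 * w$1 + w$2 * w$2 = 1"
    and uw: "u$1 * w$1 + u$2 * w$2 = 0"
    using assms by (simp_all add: norm_eq_1 orthogonal_def inner_real2)
  \<comment> \<open>The matrix with rows \<open>u\<close> and \<open>w\<close> is orthogonal, so its
    columns are orthonormal too; the expansion of the inner product needs these column
    relations.\<close>
  have 1: "u$1 * u$1 + w$1 * w$1 = 1" "u$2 * u$2 + w$2 * w$2 = 1" "u$1 * u$2 + w$1 * w$2 = 0"
    using u w uw by algebra+
  show ?thesis
    unfolding inner_real2 using 1 by algebra
qed

lemma eq_orthonormal_real2:
  fixes u w x y :: "real^2"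
  assumes "norm u = 1" "norm w = 1" "orthogonal u w"
    and "x \<bullet> u = y \<bullet> u" "x \<bullet> w = y \<bullet> w"
  shows "x = y"
proof -
  have "(x - y) \<bullet> (x - y) = 0"
    using inner_orthonormal_real2[OF assms(1-3), of "x - y" "x - y"] assms(4,5)
    by (simp add: inner_diff_left)
  then show ?thesis by simp
qed

lemma diff_affine_hull_2:
  fixes x y P Q :: "'a::real_vector"
  assumes "P \<in> affine hull {x, y}" "Q \<in> affine hull {x, y}"
  obtains k where "P - Q = k *\<^sub>R (y - x)"
proof -
  obtain s t where "P = x + s *\<^sub>R (y - x)" "Q = x + t *\<^sub>R (y - x)"
    using assms by (auto simp: affine_hull_2_alt)
  then have "P - Q = (s - t) *\<^sub>R (y - x)"
    by (simp add: scaleR_left_diff_distrib)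
  then show thesis by (rule that)
qed

lemma affine_parallel_direction:
  fixes x y c u :: "'a::real_vector"
  assumes "affine_parallel (affine hull {x, y}) (affine hull {c, c + u})"
  obtains k where "y - x = k *\<^sub>R u"
proof -
  obtain t where t: "affine hull {c, c + u} = (+) t ` (affine hull {x, y})"
    using assms by (auto simp: affine_parallel_def)
  have "t + y \<in> affine hull {c, c + u}" "t + x \<in> affine hull {c, c + u}"
    unfolding t by (auto intro: hull_inc)
  then show thesis
    by (rule diff_affine_hull_2) (use that in auto)
qed

text \<open>The left side of the ellipse equation is constant along the path, so its derivative at 0
  vanishes. The result says that radius and velocity are conjugate directions.\<close>

lemma ellipse_tangent_conjugate:
  fixes \<gamma> :: "real \<Rightarrow> 'a::real_inner"
  assumes "\<And>t. ((\<gamma> t - c) \<bullet> u)\<^sup>2 / a\<^sup>2 + ((\<gamma> t - c) \<bullet> w)\<^sup>2 / b\<^sup>2 = 1"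
    and "(\<gamma> has_vector_derivative d) (at 0)"
  shows "((\<gamma> 0 - c) \<bullet> u) * (d \<bullet> u) / a\<^sup>2 + ((\<gamma> 0 - c) \<bullet> w) * (d \<bullet> w) / b\<^sup>2 = 0"
proof -
  have D: "((\<lambda>t. (\<gamma> t - c) \<bullet> v) has_real_derivative d \<bullet> v) (at 0)" for v
  proof -
    have "((\<lambda>t. (\<gamma> t - c) \<bullet> v) has_vector_derivative (d - 0) \<bullet> v) (at 0)"
      by (intro bounded_linear.has_vector_derivative[OF bounded_linear_inner_left]
            has_vector_derivative_diff assms(2) has_vector_derivative_const)
    then show ?thesis
      by (simp add: has_real_derivative_iff_has_vector_derivative)
  qed
  have "((\<lambda>t. ((\<gamma> t - c) \<bullet> u)\<^sup>2 / a\<^sup>2 + ((\<gamma> t - c) \<bullet> w)\<^sup>2 / b\<^sup>2) has_real_derivative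
      2 * ((\<gamma> 0 - c) \<bullet> u) * (d \<bullet> u) / a\<^sup>2 + 2 * ((\<gamma> 0 - c) \<bullet> w) * (d \<bullet> w) / b\<^sup>2) (at 0)"
    using DERIV_add[OF DERIV_cdivide[OF DERIV_power[OF D[of u], of 2]]
        DERIV_cdivide[OF DERIV_power[OF D[of w], of 2]]]
    by (simp add: mult_ac)
  moreover have "((\<lambda>t. ((\<gamma> t - c) \<bullet> u)\<^sup>2 / a\<^sup>2 + ((\<gamma> t - c) \<bullet> w)\<^sup>2 / b\<^sup>2)
      has_real_derivative 0) (at 0)"
    unfolding assms(1) by simp
  ultimately show ?thesis
    using DERIV_unique by fastforce
qed

text \<open>The velocity at the point of tangency \<open>T\<close> runs along the side, hence along
  \<open>u\<close>. Conjugacy then forces \<open>T - c\<close> to have no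
  \<open>u\<close>-component, so \<open>T\<close> is an end point of the other axis. Its
  \<open>w\<close>-coordinate, b or -b, is shared by the whole side.\<close>

lemma side_tangent_parallel_axis:
  fixes u w c x y :: "real^2"
  assumes "a > 0" "b > 0" "norm u = 1" "norm w = 1" "orthogonal u w"
    and E: "E = {P. ((P - c) \<bullet> u)\<^sup>2 / a\<^sup>2 + ((P - c) \<bullet> w)\<^sup>2 / b\<^sup>2 = 1}"
    and "side_tangent E x y"
    and "affine_parallel (affine hull {x, y}) (affine hull {c, c + u})"
  shows "\<bar>(x - c) \<bullet> w\<bar> = b \<and> (y - c) \<bullet> w = (x - c) \<bullet> w"
proof -
  obtain k where k: "y - x = k *\<^sub>R u"
    using affine_parallel_direction[OF assms(8)] .
  have uw: "u \<bullet> w = 0" using assms(5) by (simp add: orthogonal_def)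
  obtain T \<gamma> d where T: "T \<in> closed_segment x y" and \<gamma>E: "\<And>t. \<gamma> t \<in> E" and \<gamma>0: "\<gamma> 0 = T"
    and \<gamma>d: "(\<gamma> has_vector_derivative d) (at 0)" and d0: "d \<noteq> 0"
    and L: "affine hull {x, y} = affine hull {T, T + d}"
    using assms(7) unfolding side_tangent_def tangent_line_at_def by blast
  have flat: "(P - Q) \<bullet> w = 0" if "P \<in> affine hull {x, y}" "Q \<in> affine hull {x, y}" for P Q
    using diff_affine_hull_2[OF that] k uw by (metis inner_scaleR_left mult_zero_right)
  have mem: "x \<in> affine hull {x, y}" "y \<in> affine hull {x, y}"
    "T \<in> affine hull {x, y}" "T + d \<in> affine hull {x, y}"
    unfolding L by (auto simp: hull_inc) (auto simp flip: L simp: hull_inc)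
  have dw: "d \<bullet> w = 0"
    using flat[OF mem(4,3)] by simp
  have du: "d \<bullet> u \<noteq> 0"
    using eq_orthonormal_real2[OF assms(3-5), of d 0] dw d0 by auto
  have "((T - c) \<bullet> u) * (d \<bullet> u) / a\<^sup>2 = 0"
    using ellipse_tangent_conjugate[OF _ \<gamma>d, of c u a w b] \<gamma>E dw unfolding E by (simp add: \<gamma>0)
  then have "(T - c) \<bullet> u = 0"
    using du assms(1) by simp
  moreover have "T \<in> E" using \<gamma>E \<gamma>0 by metis
  ultimately have "((T - c) \<bullet> w)\<^sup>2 = b\<^sup>2"
    using assms(2) by (simp add: E field_simps)
  then have "\<bar>(T - c) \<bullet> w\<bar> = b"
    using assms(2) by (metis abs_of_pos power2_eq_iff abs_minus)
  moreover have "(x - T) \<bullet> w = 0" "(y - T) \<bullet> w = 0"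
    using flat mem by auto
  ultimately show ?thesis
    by (simp add: inner_diff_left)
qed

text \<open>Only the diagonal vectors are recorded, and their coordinates only up to sign:
  perpendicularity to a diagonal depends on nothing else, and the signs disappear on
  squaring.\<close>

lemma circumscribed_rectangle_diagonals:
  fixes u w c p q r s :: "real^2"
  assumes "a > 0" "b > 0" "norm u = 1" "norm w = 1" "orthogonal u w"
    and E: "E = {P. ((P - c) \<bullet> u)\<^sup>2 / a\<^sup>2 + ((P - c) \<bullet> w)\<^sup>2 / b\<^sup>2 = 1}"
    and "circumscribed_rectangle E (affine hull {c, c + u}) (affine hull {c, c + w}) p q r s"
  shows "\<bar>(r - p) \<bullet> u\<bar> = 2 * a" "\<bar>(r - p) \<bullet> w\<bar> = 2 * b"
    "\<bar>(s - q) \<bullet> u\<bar> = 2 * a" "\<bar>(s - q) \<bullet> w\<bar> = 2 * b"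
proof -
  define X Y where "X z = (z - c) \<bullet> u" and "Y z = (z - c) \<bullet> w" for z
  \<comment> \<open>Exchanging the two summands lets the lemma on sides parallel to one axis serve
    for the other axis as well.\<close>
  have E': "E = {P. ((P - c) \<bullet> w)\<^sup>2 / b\<^sup>2 + ((P - c) \<bullet> u)\<^sup>2 / a\<^sup>2 = 1}"
    by (auto simp: E add.commute)
  have side: "\<bar>X x\<bar> = a \<and> X y = X x \<or> \<bar>Y x\<bar> = b \<and> Y y = Y x"
    if "(x, y) \<in> {(p, q), (q, r), (r, s), (s, p)}" for x y
    using that assms(7) side_tangent_parallel_axis[OF assms(1-5) E, of x y]
      side_tangent_parallel_axis[OF assms(2,1,4,3) _ E', of x y] assms(5)
    unfolding circumscribed_rectangle_def X_def Y_def by (auto simp: orthogonal_commute)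
  have rect: "p \<noteq> q" "p \<noteq> s" "r - q = s - p" "(q - p) \<bullet> (s - p) = 0"
    using assms(7) by (auto simp: circumscribed_rectangle_def rectangle_def orthogonal_def)
  have XY: "(x - y) \<bullet> u = X x - X y" "(x - y) \<bullet> w = Y x - Y y" for x y
    by (simp_all add: X_def Y_def inner_diff_left)
  have ne: "X x \<noteq> X y \<or> Y x \<noteq> Y y" if "x \<noteq> y" for x y
    using eq_orthonormal_real2[OF assms(3-5), of x y] that XY[of x y]
    by (auto simp: inner_diff_left)
  have par: "X r - X q = X s - X p" "Y r - Y q = Y s - Y p"
    using rect(3) by (metis XY)+
  have perp: "(X q - X p) * (X s - X p) + (Y q - Y p) * (Y s - Y p) = 0"
    using inner_orthonormal_real2[OF assms(3-5), of "q - p" "s - p"] rect(4) by (simp add: XY)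
  \<comment> \<open>The right angle at \<open>p\<close> makes \<open>pq\<close> parallel to one axis
    and \<open>ps\<close> to the other. Opposite sides lie on distinct lines whose coordinates have
    the same absolute value a or b, so these coordinates are opposite and differ by 2a or
    2b.\<close>
  have "\<bar>X r - X p\<bar> = 2 * a \<and> \<bar>Y r - Y p\<bar> = 2 * b \<and>
      \<bar>X s - X q\<bar> = 2 * a \<and> \<bar>Y s - Y q\<bar> = 2 * b"
  proof (cases "X q = X p")
    case True
    then have "Y q \<noteq> Y p" using ne[OF rect(1)] by auto
    moreover from this have "Y s = Y p" using perp True by simp
    moreover from this have "X s \<noteq> X p" using ne[OF rect(2)] by auto
    ultimately show ?thesis
      using True par side[of p q] side[of q r] side[of r s] side[of s p] by auto
  next
    case False
    then have "Y q = Y p" using side[of p q] by auto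
    moreover from this have "X s = X p" using perp False by simp
    moreover from calculation have "Y s \<noteq> Y p" using ne[OF rect(2)] by auto
    ultimately show ?thesis
      using False par side[of p q] side[of q r] side[of r s] side[of s p] by auto
  qed
  then show "\<bar>(r - p) \<bullet> u\<bar> = 2 * a" "\<bar>(r - p) \<bullet> w\<bar> = 2 * b"
    "\<bar>(s - q) \<bullet> u\<bar> = 2 * a" "\<bar>(s - q) \<bullet> w\<bar> = 2 * b"
    by (auto simp: XY)
qed

lemma perpendicular_to_line_affine_hull:
  "perpendicular_to_line v (affine hull {x, y}) \<Longrightarrow> v \<bullet> (y - x) = 0"
  by (auto simp: perpendicular_to_line_def orthogonal_def hull_inc)

text \<open>Reflection in \<open>C\<close> sends both ends of the axis along \<open>u\<close> into
  \<open>E\<close>. Comparing the two resulting equations shows that \<open>C - c\<close> has no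
  \<open>u\<close>-component, and either equation then removes the
  \<open>w\<close>-component.\<close>

lemma ellipse_center_of_symmetry_unique:
  fixes u w c C :: "real^2"
  assumes "a > 0" "b > 0" "norm u = 1" "norm w = 1" "orthogonal u w"
    and E: "E = {P. ((P - c) \<bullet> u)\<^sup>2 / a\<^sup>2 + ((P - c) \<bullet> w)\<^sup>2 / b\<^sup>2 = 1}"
    and C: "center_of_symmetry E C"
  shows "C = c"
proof -
  have uw: "u \<bullet> w = 0" "w \<bullet> u = 0" "u \<bullet> u = 1"
    using assms(3,5) by (auto simp: orthogonal_def inner_commute norm_eq_1)
  define x y where "x = 2 * ((C - c) \<bullet> u)" and "y = 2 * ((C - c) \<bullet> w)"
  \<comment> \<open>Relative to \<open>c\<close>, the reflected point has axis coordinates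
    \<open>x - t\<close> and \<open>y\<close>.\<close>
  have *: "(x - t)\<^sup>2 / a\<^sup>2 + y\<^sup>2 / b\<^sup>2 = 1" if "t\<^sup>2 = a\<^sup>2" for t
  proof -
    have "c + t *\<^sub>R u \<in> E"
      using assms(1) by (simp add: E uw that)
    then have "2 *\<^sub>R C - (c + t *\<^sub>R u) \<in> E"
      using C by (auto simp: center_of_symmetry_def)
    moreover have "2 *\<^sub>R C - (c + t *\<^sub>R u) - c = 2 *\<^sub>R (C - c) - t *\<^sub>R u"
      by (simp add: algebra_simps scaleR_2)
    ultimately show ?thesis
      by (simp add: E inner_diff_left[of "2 *\<^sub>R (C - c)"] uw x_def y_def)
  qed
  have "(x - a)\<^sup>2 / a\<^sup>2 = (x + a)\<^sup>2 / a\<^sup>2"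
    using *[of a] *[of "- a"] by (simp del: divide_cancel_right)
  then have x: "x = 0"
    using assms(1) by (simp add: power2_eq_square algebra_simps)
  then have "y = 0"
    using *[of a] assms(1,2) by simp
  with x show ?thesis
    using eq_orthonormal_real2[OF assms(3-5), of C c]
    by (simp add: x_def y_def inner_diff_left)
qed

text \<open>In the theorem this rules out that both axis coordinates of the two vectors differ in
  sign.\<close>

lemma independent_pair_not_opposite:
  fixes v1 v2 :: "'a::real_vector"
  assumes "v1 \<noteq> v2" "independent {v1, v2}"
  shows "v2 \<noteq> - v1"
proof
  assume "v2 = - v1"
  then have "v2 \<in> span {v1}" by (simp add: span_base span_neg)
  then show False
    using assms by (auto simp: dependent_def insert_Diff_if)
qed

theorem theorem5p4:
  fixes E A B :: "(real^2) set" and a b :: real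
    and C p q r s v1 v2 :: "real^2"
  assumes "ellipse_with_axes E A B a b"
    and "center_of_symmetry E C"
    and "circumscribed_rectangle E A B p q r s"
    and "norm v1 = 1" and "norm v2 = 1"
    and "v1 \<noteq> v2" and "independent {v1, v2}"
    and "perpendicular_to_line v1 (affine hull {p, r}) \<or> perpendicular_to_line v1 (affine hull {q, s})"
    and "perpendicular_to_line v2 (affine hull {p, r}) \<or> perpendicular_to_line v2 (affine hull {q, s})"
  shows "is_circle_E v1 v2 E C (sqrt 2 * a * b / sqrt (a\<^sup>2 + b\<^sup>2))"
proof -
  obtain c u w where b: "0 < b" and "b \<le> a"
    and on: "norm u = 1" "norm w = 1" "orthogonal u w"
    and A: "A = affine hull {c, c + u}" and B: "B = affine hull {c, c + w}"
    and E: "E = {P. ((P - c) \<bullet> u)\<^sup>2 / a\<^sup>2 + ((P - c) \<bullet> w)\<^sup>2 / b\<^sup>2 = 1}"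
    using assms(1) unfolding ellipse_with_axes_def by blast
  then have a: "0 < a" by simp
  have Cc: "C = c"
    using ellipse_center_of_symmetry_unique[OF a b on E assms(2)] .
  define N where "N = a\<^sup>2 + b\<^sup>2"
  have N: "N > 0" using a b by (simp add: N_def add_pos_pos)
  note diag = circumscribed_rectangle_diagonals[OF a b on E assms(3)[unfolded A B]]
  have coords: "N * (v \<bullet> u)\<^sup>2 = b\<^sup>2 \<and> N * (v \<bullet> w)\<^sup>2 = a\<^sup>2"
    if "norm v = 1"
      and v: "perpendicular_to_line v (affine hull {p, r}) \<or> perpendicular_to_line v (affine hull {q, s})"
    for v
  proof -
    \<comment> \<open>Here \<open>d\<close> is whichever diagonal vector \<open>v\<close> is
      perpendicular to; both have the same absolute coordinates.\<close>
    obtain d where d: "\<bar>d \<bullet> u\<bar> = 2 * a" "\<bar>d \<bullet> w\<bar> = 2 * b" "v \<bullet> d = 0"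
      using v diag perpendicular_to_line_affine_hull by metis
    have "(v \<bullet> u)\<^sup>2 + (v \<bullet> w)\<^sup>2 = 1"
      using inner_orthonormal_real2[OF on, of v v] \<open>norm v = 1\<close>
      by (simp add: norm_eq_1 power2_eq_square)
    moreover have "(v \<bullet> u)\<^sup>2 * a\<^sup>2 = (v \<bullet> w)\<^sup>2 * b\<^sup>2"
    proof -
      have "(d \<bullet> u)\<^sup>2 = 4 * a\<^sup>2" "(d \<bullet> w)\<^sup>2 = 4 * b\<^sup>2"
        using d(1,2) by (metis power2_abs four_x_squared)+
      moreover have "(v \<bullet> u) * (d \<bullet> u) = - ((v \<bullet> w) * (d \<bullet> w))"
        using inner_orthonormal_real2[OF on, of v d] d(3) by simp
      then have "((v \<bullet> u) * (d \<bullet> u))\<^sup>2 = ((v \<bullet> w) * (d \<bullet> w))\<^sup>2" by simp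
      ultimately show ?thesis by (simp add: power_mult_distrib)
    qed
    \<comment> \<open>The two relations form a linear system for the squares of the coordinates of
      \<open>v\<close>, with determinant \<open>N\<close> up to sign.\<close>
    ultimately show ?thesis unfolding N_def by algebra
  qed
  have c1: "N * (v1 \<bullet> u)\<^sup>2 = b\<^sup>2" "N * (v1 \<bullet> w)\<^sup>2 = a\<^sup>2"
    and c2: "N * (v2 \<bullet> u)\<^sup>2 = b\<^sup>2" "N * (v2 \<bullet> w)\<^sup>2 = a\<^sup>2"
    using coords assms(4,5,8,9) by auto
  have "(v1 \<bullet> u)\<^sup>2 = (v2 \<bullet> u)\<^sup>2" "(v1 \<bullet> w)\<^sup>2 = (v2 \<bullet> w)\<^sup>2"
    using c1 c2 N by (metis mult_left_cancel less_irrefl)+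
  then have sgn: "v1 \<bullet> u = v2 \<bullet> u \<or> v1 \<bullet> u = - (v2 \<bullet> u)" "v1 \<bullet> w = v2 \<bullet> w \<or> v1 \<bullet> w = - (v2 \<bullet> w)"
    by (simp_all add: power2_eq_iff)
  \<comment> \<open>If no coordinate changed sign, the vectors would be equal; if both did, they
    would be opposite. So exactly one sign changes and the two products cancel.\<close>
  have cross: "(v1 \<bullet> u) * (v1 \<bullet> w) + (v2 \<bullet> u) * (v2 \<bullet> w) = 0"
    using sgn eq_orthonormal_real2[OF on, of v1 v2] eq_orthonormal_real2[OF on, of v2 "- v1"]
      assms(6) independent_pair_not_opposite[OF assms(6,7)]
    by auto
  have "dist_E v1 v2 C P = sqrt 2 * a * b / sqrt N \<longleftrightarrow> P \<in> E" for P
  proof -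
    define x y where "x = (P - c) \<bullet> u" and "y = (P - c) \<bullet> w"
    have "dist_E v1 v2 C P = sqrt ((v1 \<bullet> (P - c))\<^sup>2 + (v2 \<bullet> (P - c))\<^sup>2)"
      unfolding dist_E_def Cc inner_real2
      by (rule arg_cong[of _ _ sqrt]) (simp add: power2_eq_square algebra_simps)
    also have "(v1 \<bullet> (P - c))\<^sup>2 + (v2 \<bullet> (P - c))\<^sup>2 = 2 * (b\<^sup>2 * x\<^sup>2 + a\<^sup>2 * y\<^sup>2) / N"
    proof -
      \<comment> \<open>In axis coordinates, \<open>c1\<close> and \<open>c2\<close> supply the
        coefficients of the squares, and \<open>cross\<close> removes the term in
        \<open>x * y\<close>.\<close>
      have "N * ((v1 \<bullet> (P - c))\<^sup>2 + (v2 \<bullet> (P - c))\<^sup>2) = 2 * (b\<^sup>2 * x\<^sup>2 + a\<^sup>2 * y\<^sup>2)"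
        unfolding inner_orthonormal_real2[OF on, of _ "P - c"] x_def[symmetric] y_def[symmetric]
        using c1 c2 cross by algebra
      then show ?thesis using N by (simp add: field_simps)
    qed
    finally have "dist_E v1 v2 C P = sqrt (2 * (b\<^sup>2 * x\<^sup>2 + a\<^sup>2 * y\<^sup>2) / N)" .
    \<comment> \<open>On \<open>E\<close> the form \<open>b^2 * x^2 + a^2 * y^2\<close> has the
      value \<open>a^2 * b^2\<close>; this is where the radius comes from.\<close>
    moreover have "sqrt 2 * a * b / sqrt N = sqrt (2 * (a\<^sup>2 * b\<^sup>2) / N)"
      using a b by (simp add: real_sqrt_mult real_sqrt_divide)
    ultimately have "dist_E v1 v2 C P = sqrt 2 * a * b / sqrt N \<longleftrightarrow>
        b\<^sup>2 * x\<^sup>2 + a\<^sup>2 * y\<^sup>2 = a\<^sup>2 * b\<^sup>2"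
      using N by (simp del: distrib_left_numeral)
    also have "\<dots> \<longleftrightarrow> P \<in> E"
      using a b by (auto simp: E x_def[symmetric] y_def[symmetric] field_simps)
    finally show ?thesis .
  qed
  moreover have "0 < sqrt 2 * a * b / sqrt N" using a b N by simp
  ultimately show ?thesis
    unfolding is_circle_E_def N_def by auto
qed

end
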